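(* Let $A, B$ be positive definite $n\times n$ complex matrices, let $m\in\{1,2,\dots\}$, and for $0<\nu\le 1$ put $r=\min\{\nu,1-\nu\}$ and $r_0=\min\{2r,1-2r\}$. If $0<\nu\leq\frac12$, then $$\left(\mathrm{tr}|A^{1-\nu}B^{\nu}|\right)^{m}+\nu^{m}\left(\mathrm{tr}A+\mathrm{tr}B\right)^{m}-\left(2\nu(\mathrm{tr}(A)\,\mathrm{tr}(B))^{\frac12}-r_{0}\left((\mathrm{tr}(A)\,\mathrm{tr}(B))^{\frac14}-(\mathrm{tr}(A))^{\frac12}\right)^{2}\right)^{m}\leq\left(\mathrm{tr}((1-\nu)A+\nu B)\right)^{m},$$ and if $\frac12\leq\nu\leq1$, then $$\left(\mathrm{tr}|A^{1-\nu}B^{\nu}|\right)^{m}+(1-\nu)^{m}\left(\mathrm{tr}A+\mathrm{tr}B\right)^{m}-\left(2(1-\nu)(\mathrm{tr}(A)\,\mathrm{tr}(B))^{\frac12}-r_{0}\left((\mathrm{tr}(A)\,\mathrm{tr}(B))^{\frac14}-(\mathrm{tr}(B))^{\frac12}\right)^{2}\right)^{m}\leq\left(\mathrm{tr}((1-\nu)A+\nu B)\right)^{m}.$$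
   Context: For a matrix $T$, $|T|=(T^*T)^{1/2}$, so $\mathrm{tr}|T|$ is the trace norm of $T$ (the sum of its singular values). Real powers of positive definite matrices are defined by the spectral functional calculus. *)

theory Defs
  imports "HOL-Analysis.Analysis"
begin

definition adjoint_mat :: "complex^'n^'n \<Rightarrow> complex^'n^'n" where
  "adjoint_mat A = map_matrix cnj (transpose A)"

definition unitary_mat :: "complex^'n^'n \<Rightarrow> bool" where
  "unitary_mat U \<longleftrightarrow> adjoint_mat U ** U = mat 1 \<and> U ** adjoint_mat U = mat 1"

definition hermitian_mat :: "complex^'n^'n \<Rightarrow> bool" where
  "hermitian_mat A \<longleftrightarrow> adjoint_mat A = A"

text \<open>For Hermitian \<open>A\<close> the form below is real, so taking its real part loses nothing.\<close>

definition positive_definite :: "complex^'n^'n \<Rightarrow> bool" where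
  "positive_definite A \<longleftrightarrow>
     hermitian_mat A \<and> (\<forall>x. x \<noteq> 0 \<longrightarrow> 0 < Re (\<Sum>i\<in>UNIV. cnj (x $ i) * (A *v x) $ i))"

definition real_diag_mat :: "('n \<Rightarrow> real) \<Rightarrow> complex^'n^'n" where
  "real_diag_mat d = (\<chi> i j. if i = j then complex_of_real (d i) else 0)"

text \<open>
  Spectral functional calculus: if \<open>A = U diag(d) U*\<close> with \<open>U\<close> unitary and \<open>d\<close> real,
  then \<open>f(A) = U diag(f \<circ> d) U*\<close>. Such a decomposition exists exactly for Hermitian \<open>A\<close>,
  and the result does not depend on its choice (\<open>spectral_fun_eq\<close> below). For other matrices
  the value is unspecified.
\<close>

definition spectral_fun :: "(real \<Rightarrow> real) \<Rightarrow> complex^'n^'n \<Rightarrow> complex^'n^'n" where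
  "spectral_fun f A = (THE X. \<exists>U d. unitary_mat U
      \<and> A = U ** real_diag_mat d ** adjoint_mat U
      \<and> X = U ** real_diag_mat (\<lambda>i. f (d i)) ** adjoint_mat U)"

lemma real_diag_mult_nth: "(real_diag_mat d ** W) $ i $ j = complex_of_real (d i) * W $ i $ j"
proof -
  have "(real_diag_mat d ** W) $ i $ j =
      (\<Sum>k\<in>UNIV. if k = i then complex_of_real (d i) * W $ k $ j else 0)"
    unfolding matrix_matrix_mult_def real_diag_mat_def vec_lambda_beta
    by (rule sum.cong) auto
  then show ?thesis by simp
qed

lemma mult_real_diag_nth: "(W ** real_diag_mat d) $ i $ j = W $ i $ j * complex_of_real (d j)"
proof -
  have "(W ** real_diag_mat d) $ i $ j =
      (\<Sum>k\<in>UNIV. if k = j then W $ i $ k * complex_of_real (d j) else 0)"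
    unfolding matrix_matrix_mult_def real_diag_mat_def vec_lambda_beta
    by (rule sum.cong) auto
  then show ?thesis by simp
qed

lemma spectral_fun_unique:
  fixes U V :: "complex^'n^'n"
  assumes U: "unitary_mat U" and V: "unitary_mat V"
    and eq: "U ** real_diag_mat d ** adjoint_mat U = V ** real_diag_mat e ** adjoint_mat V"
  shows "U ** real_diag_mat (\<lambda>i. f (d i)) ** adjoint_mat U =
         V ** real_diag_mat (\<lambda>i. f (e i)) ** adjoint_mat V"
proof -
  define W where "W = adjoint_mat V ** U"
  have UU: "adjoint_mat U ** U = mat 1" "U ** adjoint_mat U = mat 1"
    and VV: "adjoint_mat V ** V = mat 1" "V ** adjoint_mat V = mat 1"
    using U V by (auto simp: unitary_mat_def)
  have "W ** real_diag_mat d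
      = adjoint_mat V ** (U ** real_diag_mat d ** adjoint_mat U) ** U"
    by (simp add: W_def UU flip: matrix_mul_assoc)
  also have "\<dots> = (adjoint_mat V ** V) ** real_diag_mat e ** (adjoint_mat V ** U)"
    unfolding eq by (simp add: matrix_mul_assoc)
  also have "\<dots> = real_diag_mat e ** W"
    by (simp add: VV W_def)
  finally have *: "W ** real_diag_mat d = real_diag_mat e ** W" .
  have "W $ i $ j * complex_of_real (d j) = complex_of_real (e i) * W $ i $ j" for i j
    using arg_cong[OF *, of "\<lambda>M. M $ i $ j"]
    by (simp add: real_diag_mult_nth mult_real_diag_nth)
  then have "W $ i $ j = 0 \<or> d j = e i" for i j
    by (auto simp: mult.commute)
  then have "W $ i $ j * complex_of_real (f (d j)) = complex_of_real (f (e i)) * W $ i $ j" for i j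
    by (smt (verit) mult.commute mult_zero_left)
  then have **: "W ** real_diag_mat (\<lambda>i. f (d i)) = real_diag_mat (\<lambda>i. f (e i)) ** W"
    by (simp add: vec_eq_iff real_diag_mult_nth mult_real_diag_nth)
  have "U ** real_diag_mat (\<lambda>i. f (d i)) ** adjoint_mat U
      = V ** (W ** real_diag_mat (\<lambda>i. f (d i))) ** adjoint_mat U"
    by (simp add: W_def VV matrix_mul_assoc)
  also have "\<dots> = V ** real_diag_mat (\<lambda>i. f (e i)) ** adjoint_mat V ** (U ** adjoint_mat U)"
    unfolding ** by (simp add: W_def matrix_mul_assoc)
  finally show ?thesis by (simp add: UU)
qed

lemma spectral_fun_eq:
  assumes "unitary_mat U"
  shows "spectral_fun f (U ** real_diag_mat d ** adjoint_mat U) =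
         U ** real_diag_mat (\<lambda>i. f (d i)) ** adjoint_mat U"
  unfolding spectral_fun_def
proof (rule the_equality)
  show "\<exists>U' d'. unitary_mat U'
      \<and> U ** real_diag_mat d ** adjoint_mat U = U' ** real_diag_mat d' ** adjoint_mat U'
      \<and> U ** real_diag_mat (\<lambda>i. f (d i)) ** adjoint_mat U =
          U' ** real_diag_mat (\<lambda>i. f (d' i)) ** adjoint_mat U'"
    using assms by (intro exI conjI) (rule refl | assumption)+
next
  fix X
  assume "\<exists>U' d'. unitary_mat U'
      \<and> U ** real_diag_mat d ** adjoint_mat U = U' ** real_diag_mat d' ** adjoint_mat U'
      \<and> X = U' ** real_diag_mat (\<lambda>i. f (d' i)) ** adjoint_mat U'"
  then obtain U' d' where U': "unitary_mat U'"
    and eq: "U ** real_diag_mat d ** adjoint_mat U = U' ** real_diag_mat d' ** adjoint_mat U'"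
    and X: "X = U' ** real_diag_mat (\<lambda>i. f (d' i)) ** adjoint_mat U'"
    by blast
  show "X = U ** real_diag_mat (\<lambda>i. f (d i)) ** adjoint_mat U"
    unfolding X by (rule spectral_fun_unique [OF assms U' eq, symmetric])
qed

definition mat_powr :: "complex^'n^'n \<Rightarrow> real \<Rightarrow> complex^'n^'n" where
  "mat_powr A s = spectral_fun (\<lambda>x. x powr s) A"

definition mat_abs :: "complex^'n^'n \<Rightarrow> complex^'n^'n" where
  "mat_abs T = mat_powr (adjoint_mat T ** T) (1/2)"

text \<open>
  Real-valued trace; only applied to Hermitian matrices, whose trace is real.
\<close>

definition tr :: "complex^'n^'n \<Rightarrow> real" where
  "tr A = Re (trace A)"

end

theory Submission
  imports Defs
begin

text \<open>
  Put \<open>a = tr A\<close>, \<open>b = tr B\<close> and \<open>X = tr \<bar>A\<^sup>1\<^sup>-\<^sup>\<nu> B\<^sup>\<nu>\<bar>\<close>. The matrices enter only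
  through the Hoelder bound \<open>0 \<le> X \<le> a\<^sup>1\<^sup>-\<^sup>\<nu> b\<^sup>\<nu>\<close> (\<open>tr_abs_mat_powr_Holder\<close>); the rest is
  about two positive numbers.

  For the Hoelder bound, diagonalize \<open>A\<close> and \<open>B\<close> by unitaries \<open>U\<close> and \<open>V\<close>, with eigenvalues
  \<open>c\<^sub>j\<close> and \<open>e\<^sub>i\<close>, and use the polar decomposition to write \<open>\<bar>T\<bar> = W* T\<close> with \<open>W\<close> unitary. Cyclicity
  of the trace turns \<open>X\<close> into \<open>\<Sum>\<^sub>i\<^sub>j P\<^sub>i\<^sub>j Q\<^sub>j\<^sub>i c\<^sub>j\<^sup>1\<^sup>-\<^sup>\<nu> e\<^sub>i\<^sup>\<nu>\<close> for the unitary matrices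
  \<open>P = V* W* U\<close> and \<open>Q = U* V\<close>. Now \<open>\<bar>P\<^sub>i\<^sub>j Q\<^sub>j\<^sub>i\<bar>\<close> is at most the mean of
  \<open>\<bar>P\<^sub>i\<^sub>j\<bar>\<^sup>2\<close> and \<open>\<bar>Q\<^sub>j\<^sub>i\<bar>\<^sup>2\<close>, which is a doubly stochastic matrix, and for doubly
  stochastic weights Hoelder's inequality follows from Young's inequality applied to the eigenvalues
  divided by \<open>a\<close> and \<open>b\<close>.

  For the numbers, let \<open>\<nu> \<le> 1/2\<close>; the other half is the same with \<open>a\<close>, \<open>b\<close> and
  \<open>\<nu>\<close>, \<open>1 - \<nu>\<close> exchanged. Put \<open>Y = \<nu> (a + b)\<close>, \<open>W = (1 - \<nu>) a + \<nu> b\<close>, and let \<open>Z\<close>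
  be the number whose \<open>m\<close>-th power is subtracted. A refinement of Young's inequality, used with \<open>a\<close>,
  \<open>\<surd>(a b)\<close> and the weight \<open>2 \<nu>\<close>, gives \<open>X + Y \<le> W + Z\<close>, the case \<open>m = 1\<close>
  (\<open>Young_refined_twice\<close>). Since \<open>Z \<le> Y \<le> W\<close>, the passage to
  \<open>X\<^sup>m + Y\<^sup>m - Z\<^sup>m \<le> W\<^sup>m\<close> is elementary (\<open>power_shift_le\<close>). The number \<open>Z\<close> may
  be negative, for instance when \<open>\<nu> < 1/2\<close> and \<open>b\<close> is small against \<open>a\<close>, and that case needs an argument of its own.
\<close>

section \<open>Refined Young inequalities and their powers\<close>

lemma power_add_le_add_power:
  fixes a b :: real
  assumes "0 \<le> a" and "0 \<le> b" and "1 \<le> m"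
  shows "a ^ m + b ^ m \<le> (a + b) ^ m"
  using \<open>1 \<le> m\<close>
proof (induction m rule: dec_induct)
  case (step m)
  have "a ^ Suc m + b ^ Suc m \<le> (a + b) * (a ^ m + b ^ m)"
    using assms by (simp add: algebra_simps)
  also have "\<dots> \<le> (a + b) * (a + b) ^ m"
    using assms step.IH by (intro mult_left_mono) auto
  finally show ?case by simp
qed simp

text \<open>
  For \<open>0 \<le> Z < X\<close>, both \<open>X\<^sup>m - Z\<^sup>m\<close> and \<open>W\<^sup>m - Y\<^sup>m\<close> factor as a difference times
  a sum of monomials. The hypotheses say \<open>X - Z \<le> W - Y\<close>, and \<open>X \<le> W\<close>, \<open>Z \<le> Y\<close> compare the
  monomials. For \<open>Z < 0\<close> these monomials have mixed signs, but then the nonnegative numbers \<open>X\<close>,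
  \<open>Y\<close> and \<open>\<bar>Z\<bar>\<close> have a sum of at most \<open>W\<close>, and superadditivity of the power is enough.
\<close>

lemma power_shift_le:
  fixes X Y Z W :: real
  assumes "0 \<le> X" and "0 \<le> Y" and "Z \<le> Y" and "Y \<le> W" and "X + Y \<le> W + Z" and "1 \<le> m"
  shows "X ^ m + Y ^ m - Z ^ m \<le> W ^ m"
proof (cases "0 \<le> Z")
  case True
  show ?thesis
  proof (cases "X \<le> Z")
    case True
    then show ?thesis
      using assms power_mono[of X Z m] power_mono[of Y W m] by linarith
  next
    case False
    have "X ^ m - Z ^ m = (X - Z) * (\<Sum>i<m. Z ^ (m - Suc i) * X ^ i)"
      by (rule power_diff_sumr2)
    also have "\<dots> \<le> (W - Y) * (\<Sum>i<m. Y ^ (m - Suc i) * W ^ i)"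
      using assms False \<open>0 \<le> Z\<close>
      by (intro mult_mono sum_mono power_mono sum_nonneg) auto
    also have "\<dots> = W ^ m - Y ^ m"
      by (rule power_diff_sumr2 [symmetric])
    finally show ?thesis by simp
  qed
next
  case False
  have "- (Z ^ m) \<le> (- Z) ^ m"
    using abs_ge_minus_self [of "Z ^ m"] False by (simp add: power_abs)
  moreover have "X ^ m + Y ^ m + (- Z) ^ m \<le> (X + Y + (- Z)) ^ m"
    using power_add_le_add_power[of X Y m] power_add_le_add_power[of "X + Y" "- Z" m] assms False
    by auto
  moreover have "(X + Y + (- Z)) ^ m \<le> W ^ m"
    using assms False by (intro power_mono) auto
  ultimately show ?thesis by linarith
qed

text \<open>
  Subtracting \<open>\<mu> (\<surd>x - \<surd>y)\<^sup>2\<close> from the arithmetic mean leaves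
  \<open>(1 - 2 \<mu>) x + 2 \<mu> \<surd>(x y)\<close>, again a weighted mean, and the corresponding geometric mean
  is the same \<open>x\<^sup>1\<^sup>-\<^sup>\<mu> y\<^sup>\<mu>\<close>.
\<close>

lemma Young_refined_half:
  fixes x y :: real
  assumes "0 < x" and "0 < y" and "0 \<le> \<mu>" and "\<mu> \<le> 1/2"
  shows "x powr (1 - \<mu>) * y powr \<mu> + \<mu> * (sqrt x - sqrt y) ^ 2 \<le> (1 - \<mu>) * x + \<mu> * y"
proof -
  have "x powr (1 - 2 * \<mu>) * sqrt (x * y) powr (2 * \<mu>) \<le> (1 - 2 * \<mu>) * x + 2 * \<mu> * sqrt (x * y)"
    using assms by (intro Youngs_inequality_0) auto
  moreover have "x powr (1 - 2 * \<mu>) * sqrt (x * y) powr (2 * \<mu>) = x powr (1 - \<mu>) * y powr \<mu>"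
    using assms
    by (simp add: powr_half_sqrt[symmetric] powr_powr powr_mult mult.assoc[symmetric]
        powr_add[symmetric])
  moreover have "\<mu> * (sqrt x - sqrt y) ^ 2 = \<mu> * x + \<mu> * y - 2 * \<mu> * sqrt (x * y)"
    using assms by (simp add: power2_diff real_sqrt_mult algebra_simps)
  ultimately show ?thesis
    by (simp add: algebra_simps)
qed

lemma Young_refined:
  fixes x y :: real
  assumes "0 < x" and "0 < y" and "0 \<le> \<mu>" and "\<mu> \<le> 1"
  shows "x powr (1 - \<mu>) * y powr \<mu> + min \<mu> (1 - \<mu>) * (sqrt x - sqrt y) ^ 2
         \<le> (1 - \<mu>) * x + \<mu> * y"
proof (cases "\<mu> \<le> 1/2")
  case True
  then show ?thesis using Young_refined_half[of x y \<mu>] assms by simp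
next
  case False
  then show ?thesis using Young_refined_half[of y x "1 - \<mu>"] assms
    by (simp add: algebra_simps power2_commute)
qed

text \<open>
  Again \<open>(1 - \<nu>) a + \<nu> b - \<nu> (\<surd>a - \<surd>b)\<^sup>2 = (1 - 2 \<nu>) a + 2 \<nu> \<surd>(a b)\<close>. Applying
  the refined inequality, rather than the plain one, to this second mean of \<open>a\<close> and \<open>\<surd>(a b)\<close>
  produces the additional square.
\<close>

lemma Young_refined_twice:
  fixes a b :: real
  assumes "0 < a" and "0 < b" and "0 \<le> \<nu>" and "\<nu> \<le> 1/2"
  shows "a powr (1 - \<nu>) * b powr \<nu> + \<nu> * (a + b)
         \<le> (1 - \<nu>) * a + \<nu> * b
           + (2 * \<nu> * (a * b) powr (1/2)
               - min (2 * \<nu>) (1 - 2 * \<nu>) * ((a * b) powr (1/4) - a powr (1/2)) ^ 2)"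
proof -
  have "a powr (1 - 2 * \<nu>) * ((a * b) powr (1/2)) powr (2 * \<nu>)
        + min (2 * \<nu>) (1 - 2 * \<nu>) * (sqrt a - sqrt ((a * b) powr (1/2))) ^ 2
        \<le> (1 - 2 * \<nu>) * a + 2 * \<nu> * (a * b) powr (1/2)"
    using assms by (intro Young_refined) auto
  moreover have "a powr (1 - 2 * \<nu>) * ((a * b) powr (1/2)) powr (2 * \<nu>) = a powr (1 - \<nu>) * b powr \<nu>"
    using assms
    by (simp add: powr_powr powr_mult mult.assoc[symmetric] powr_add[symmetric])
  moreover have "sqrt ((a * b) powr (1/2)) = (a * b) powr (1/4)"
    using assms by (simp add: powr_half_sqrt[symmetric] powr_powr)
  moreover have "sqrt a = a powr (1/2)"
    using assms by (simp add: powr_half_sqrt)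
  ultimately show ?thesis
    by (simp add: algebra_simps power2_commute)
qed

text \<open>
  Besides the case \<open>m = 1\<close>, the passage to powers needs \<open>Z \<le> \<nu> (a + b) \<le> (1 - \<nu>) a + \<nu> b\<close>: the first
  step is the inequality of the arithmetic and geometric means, the second is \<open>\<nu> \<le> 1 - \<nu>\<close>.
\<close>

lemma power_Young_refined:
  fixes a b X :: real
  assumes "0 < a" and "0 < b" and "0 \<le> \<nu>" and "\<nu> \<le> 1/2" and "1 \<le> m"
    and "0 \<le> X" and "X \<le> a powr (1 - \<nu>) * b powr \<nu>"
  shows "X ^ m + \<nu> ^ m * (a + b) ^ m
         - (2 * \<nu> * (a * b) powr (1/2)
             - min (2 * \<nu>) (1 - 2 * \<nu>) * ((a * b) powr (1/4) - a powr (1/2)) ^ 2) ^ m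
         \<le> ((1 - \<nu>) * a + \<nu> * b) ^ m"
proof -
  define Z where "Z = 2 * \<nu> * (a * b) powr (1/2)
    - min (2 * \<nu>) (1 - 2 * \<nu>) * ((a * b) powr (1/4) - a powr (1/2)) ^ 2"
  have "Z \<le> 2 * \<nu> * (a * b) powr (1/2)"
    using assms by (simp add: Z_def)
  also have "\<dots> = \<nu> * (2 * sqrt (a * b))"
    using assms by (simp add: powr_half_sqrt)
  also have "\<dots> \<le> \<nu> * (a + b)"
    using assms arith_geo_mean_sqrt[of a b] by (intro mult_left_mono) auto
  finally have "Z \<le> \<nu> * (a + b)" .
  moreover have "\<nu> * (a + b) \<le> (1 - \<nu>) * a + \<nu> * b"
    using assms mult_right_mono[of \<nu> "1 - \<nu>" a] by (simp add: distrib_left)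
  moreover have "X + \<nu> * (a + b) \<le> (1 - \<nu>) * a + \<nu> * b + Z"
    using Young_refined_twice[of a b \<nu>] assms by (simp add: Z_def)
  ultimately have "X ^ m + (\<nu> * (a + b)) ^ m - Z ^ m \<le> ((1 - \<nu>) * a + \<nu> * b) ^ m"
    using assms by (intro power_shift_le) auto
  then show ?thesis
    by (simp add: Z_def power_mult_distrib)
qed

section \<open>Diagonalization of Hermitian matrices\<close>

text \<open>
  The Hermitian form is kept apart from the inner product of the type class, which is its real part.
  The latter makes \<open>complex^'n\<close> a real Euclidean space, so that compactness and orthogonal complements
  are available; orthogonality over the complex numbers is expressed by \<open>hinner\<close>.
\<close>

definition hinner :: "complex^'n \<Rightarrow> complex^'n \<Rightarrow> complex" where
  "hinner x y = (\<Sum>i\<in>UNIV. cnj (x $ i) * y $ i)"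

lemma hinner_eq_inner: "hinner x y = Complex (x \<bullet> y) ((\<i> *s x) \<bullet> y)"
  by (simp add: complex_eq_iff hinner_def inner_vec_def inner_complex_def sum_negf
      algebra_simps flip: sum_subtractf)

lemma hinner_self: "hinner x x = complex_of_real (x \<bullet> x)"
  by (simp add: complex_eq_iff hinner_def inner_vec_def inner_complex_def mult.commute)

lemma hinner_cnj: "cnj (hinner x y) = hinner y x"
  by (simp add: hinner_def mult.commute)

lemma hinner_scale_right: "hinner x (c *s y) = c * hinner x y"
  by (simp add: hinner_def sum_distrib_left mult_ac)

lemma adjoint_mat_nth: "adjoint_mat M $ i $ j = cnj (M $ j $ i)"
  by (simp add: adjoint_mat_def map_matrix_def transpose_def)

lemma hinner_adjoint: "hinner (adjoint_mat M *v x) y = hinner x (M *v y)"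
proof -
  have "hinner (adjoint_mat M *v x) y = (\<Sum>i\<in>UNIV. \<Sum>j\<in>UNIV. cnj (x $ j) * (M $ j $ i * y $ i))"
    by (simp add: hinner_def matrix_vector_mult_def adjoint_mat_nth sum_distrib_left
        sum_distrib_right mult_ac)
  also have "\<dots> = hinner x (M *v y)"
    by (subst sum.swap) (simp add: hinner_def matrix_vector_mult_def sum_distrib_left)
  finally show ?thesis .
qed

lemma adjoint_mat_mult: "adjoint_mat (M ** N) = adjoint_mat N ** adjoint_mat M"
  by (simp add: vec_eq_iff adjoint_mat_nth matrix_matrix_mult_def mult.commute)

lemma adjoint_mat_adjoint [simp]: "adjoint_mat (adjoint_mat M) = M"
  by (simp add: vec_eq_iff adjoint_mat_nth)

lemma adjoint_real_diag [simp]: "adjoint_mat (real_diag_mat d) = real_diag_mat d"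
  by (simp add: vec_eq_iff adjoint_mat_nth real_diag_mat_def)

lemma real_diag_mult: "real_diag_mat c ** real_diag_mat d = real_diag_mat (\<lambda>i. c i * d i)"
  by (simp add: vec_eq_iff real_diag_mult_nth) (simp add: real_diag_mat_def)

lemma real_diag_one: "real_diag_mat (\<lambda>i. 1) = mat 1"
  by (simp add: vec_eq_iff real_diag_mat_def mat_def)

lemma linear_matrix_vector_mul: "linear (\<lambda>x. (M :: complex^'n^'m) *v x)"
  by (rule linearI, rule matrix_vector_right_distrib)
    (simp add: vec_eq_iff matrix_vector_mult_def scaleR_sum_right)

lemma hermitian_inner: "hermitian_mat A \<Longrightarrow> (A *v x) \<bullet> y = x \<bullet> (A *v y)"
  using arg_cong[OF hinner_adjoint[of A x y], of Re]
  by (simp add: hermitian_mat_def hinner_eq_inner)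

text \<open>
  First-order condition at a maximum of a quadratic form: if \<open>p = \<bar>B x\<bar>\<^sup>2 > 0\<close>, then moving from \<open>x\<close>
  in the direction \<open>B x\<close> raises the form with slope \<open>2 p\<close> from its maximal value \<open>0\<close>.
\<close>

lemma nonpos_form_zero_imp_kernel:
  fixes B :: "'a::euclidean_space \<Rightarrow> 'a"
  assumes lin: "linear B" and sym: "\<And>x y. B x \<bullet> y = x \<bullet> B y"
    and S: "subspace S" "B ` S \<subseteq> S"
    and nonpos: "\<And>y. y \<in> S \<Longrightarrow> y \<bullet> B y \<le> 0"
    and x: "x \<in> S" "x \<bullet> B x = 0"
  shows "B x = 0"
proof (rule ccontr)
  assume nz: "B x \<noteq> 0"
  define p where "p = B x \<bullet> B x"
  define q where "q = B x \<bullet> B (B x)"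
  have p: "p > 0" using nz by (simp add: p_def)
  have *: "2 * t * p + t\<^sup>2 * q \<le> 0" for t
  proof -
    have "x + t *\<^sub>R B x \<in> S"
      using S x by (intro subspace_add subspace_scale) auto
    then have "(x + t *\<^sub>R B x) \<bullet> B (x + t *\<^sub>R B x) \<le> 0" by (rule nonpos)
    then show ?thesis
      using x(2) sym[of x "B x"]
      by (simp add: linear_add[OF lin] linear_cmul[OF lin] inner_add_left inner_add_right
          p_def q_def power2_eq_square algebra_simps)
  qed
  have "q \<le> 0" using S x nonpos[of "B x"] by (auto simp: q_def)
  \<comment> \<open>The step \<open>t = p / (1 - q)\<close> is short enough for the linear term \<open>2 t p\<close> to exceed \<open>- t\<^sup>2 q\<close>.\<close>
  have "2 * (p / (1 - q)) * p + (p / (1 - q))\<^sup>2 * q = (p\<^sup>2 / (1 - q)\<^sup>2) * (2 - q)"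
    using \<open>q \<le> 0\<close> by (simp add: divide_simps power2_eq_square) (simp add: algebra_simps)
  moreover have "(p\<^sup>2 / (1 - q)\<^sup>2) * (2 - q) > 0"
    using p \<open>q \<le> 0\<close> by (intro mult_pos_pos divide_pos_pos) auto
  ultimately show False using *[of "p / (1 - q)"] by linarith
qed

text \<open>
  A maximum point \<open>x\<close> of the form \<open>x \<bullet> A x\<close> on the unit sphere of \<open>S\<close> is an eigenvector: with \<open>c\<close>
  the maximal value, \<open>A - c\<close> has a nonpositive form on \<open>S\<close> that vanishes at \<open>x\<close>.
\<close>

lemma hermitian_eigenvector_in_subspace:
  fixes A :: "complex^'n^'n"
  assumes A: "hermitian_mat A" and S: "subspace S" "\<And>x. x \<in> S \<Longrightarrow> A *v x \<in> S"
    and nonzero: "z \<in> S" "z \<noteq> 0"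
  obtains x c where "x \<in> S" "norm x = 1" "A *v x = c *\<^sub>R x"
proof -
  let ?K = "S \<inter> sphere 0 1"
  have lin: "linear ((*v) A)" by (rule linear_matrix_vector_mul)
  have "compact ?K"
    using S by (intro closed_Int_compact closed_subspace) auto
  moreover have "(1 / norm z) *\<^sub>R z \<in> ?K"
    using nonzero S by (auto intro: subspace_scale)
  moreover have "continuous_on ?K (\<lambda>x. x \<bullet> (A *v x))"
    using lin by (intro continuous_on_inner continuous_on_id linear_continuous_on)
      (simp add: linear_conv_bounded_linear)
  ultimately obtain x where x: "x \<in> ?K" and max: "\<And>y. y \<in> ?K \<Longrightarrow> y \<bullet> (A *v y) \<le> x \<bullet> (A *v x)"
    using continuous_attains_sup[of ?K] by blast
  define c where "c = x \<bullet> (A *v x)"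
  define B where "B = (\<lambda>y. A *v y - c *\<^sub>R y)"
  have "B x = 0"
  proof (rule nonpos_form_zero_imp_kernel[of B S])
    show "linear B"
      unfolding B_def using lin linear_scaleR by (rule linear_compose_sub)
    show "B y \<bullet> w = y \<bullet> B w" for y w
      using hermitian_inner[OF A, of y w] by (simp add: B_def inner_diff_left inner_diff_right)
    show "B ` S \<subseteq> S"
      using S by (auto simp: B_def intro: subspace_diff subspace_scale)
    show "y \<bullet> B y \<le> 0" if "y \<in> S" for y
    proof (cases "y = 0")
      case False
      have "((1 / norm y) *\<^sub>R y) \<bullet> (A *v ((1 / norm y) *\<^sub>R y)) \<le> c"
        unfolding c_def using that S False by (intro max) (auto intro: subspace_scale)
      then have "y \<bullet> (A *v y) \<le> c * (norm y)\<^sup>2"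
        using False by (simp add: linear_cmul[OF lin] field_simps power2_eq_square)
      then show ?thesis
        by (simp add: B_def inner_diff_right dot_square_norm)
    qed (simp add: B_def)
    show "x \<bullet> B x = 0"
      using x by (simp add: B_def inner_diff_right c_def dot_square_norm)
  qed (use x S in auto)
  then show ?thesis
    using that[of x c] x by (simp add: B_def)
qed

text \<open>
  Orthogonality to \<open>v\<close> over the complex numbers is real orthogonality to \<open>v\<close> and to \<open>\<i> v\<close>, and the
  \<open>2 (card F)\<close> vectors obtained this way cannot span a real space of dimension \<open>2 n\<close>.
\<close>

lemma exists_hinner_orthogonal:
  fixes F :: "(complex^'n) set"
  assumes "finite F" and "card F < CARD('n)"
  obtains z where "z \<noteq> 0" "\<And>v. v \<in> F \<Longrightarrow> hinner v z = 0"
proof -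
  let ?G = "F \<union> (\<lambda>v. \<i> *s v) ` F"
  have "dim ?G \<le> card ?G" using assms by (intro dim_le_card') auto
  also have "\<dots> \<le> card F + card F"
    using assms card_image_le[of F "\<lambda>v. \<i> *s v"] card_Un_le[of F "(\<lambda>v. \<i> *s v) ` F"] by linarith
  also have "\<dots> < DIM(complex^'n)" using assms by simp
  finally obtain z where z: "z \<noteq> 0" "\<And>y. y \<in> span ?G \<Longrightarrow> orthogonal z y"
    using orthogonal_to_subspace_exists by blast
  have "hinner v z = 0" if "v \<in> F" for v
  proof -
    have "z \<bullet> v = 0" "z \<bullet> (\<i> *s v) = 0"
      using that z(2)[OF span_base] by (auto simp: orthogonal_def)
    then show ?thesis by (simp add: hinner_eq_inner inner_commute zero_complex.code)
  qed
  with z(1) show ?thesis by (rule that)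
qed

definition orthonormal_eigenvectors :: "complex^'n^'n \<Rightarrow> (complex^'n) set \<Rightarrow> bool" where
  "orthonormal_eigenvectors A F \<longleftrightarrow>
     (\<forall>v\<in>F. \<forall>w\<in>F. hinner v w = (if v = w then 1 else 0)) \<and> (\<forall>v\<in>F. \<exists>c::real. A *v v = c *\<^sub>R v)"

lemma scaleR_eq_vector_scale: "c *\<^sub>R (x :: complex^'n) = complex_of_real c *s x"
  by (simp add: vec_eq_iff) (simp add: scaleR_conv_of_real)

text \<open>
  The vectors orthogonal to a family of eigenvectors form an \<open>A\<close>-invariant subspace, because \<open>A\<close> is
  Hermitian. A further eigenvector can therefore be found inside it, until there are \<open>n\<close> of them.
\<close>

lemma orthonormal_eigenvectors_exist:
  fixes A :: "complex^'n^'n"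
  assumes A: "hermitian_mat A" and "k \<le> CARD('n)"
  shows "\<exists>F. finite F \<and> card F = k \<and> orthonormal_eigenvectors A F"
  using \<open>k \<le> CARD('n)\<close>
proof (induction k)
  case 0
  then show ?case by (intro exI[of _ "{}"]) (simp add: orthonormal_eigenvectors_def)
next
  case (Suc k)
  then obtain F where F: "finite F" "card F = k" "orthonormal_eigenvectors A F" by auto
  define S where "S = {x. \<forall>v\<in>F. hinner v x = 0}"
  have "subspace S"
    by (auto simp: S_def subspace_def hinner_eq_inner inner_add_right complex_eq_iff)
  moreover have "A *v x \<in> S" if "x \<in> S" for x
  proof -
    have "hinner v (A *v x) = 0" if v: "v \<in> F" for v
    proof -
      have "\<exists>c::real. A *v v = complex_of_real c *s v"
        using F(3) v unfolding orthonormal_eigenvectors_def scaleR_eq_vector_scale by blast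
      then obtain c :: real where "A *v v = complex_of_real c *s v" by blast
      then have "hinner v (A *v x) = hinner (complex_of_real c *s v) x"
        using hinner_adjoint[of A v x] A by (simp add: hermitian_mat_def)
      also have "\<dots> = cnj (complex_of_real c * hinner x v)"
        by (simp add: hinner_scale_right flip: hinner_cnj[of x])
      also have "hinner x v = 0"
        using \<open>x \<in> S\<close> v hinner_cnj[of v x] by (simp add: S_def)
      finally show ?thesis by simp
    qed
    then show ?thesis by (simp add: S_def)
  qed
  moreover have "card F < CARD('n)" using F Suc.prems by simp
  then obtain z where "z \<noteq> 0" "\<And>v. v \<in> F \<Longrightarrow> hinner v z = 0"
    using exists_hinner_orthogonal F(1) by blast
  then have "z \<in> S" "z \<noteq> 0" by (simp_all add: S_def)
  ultimately obtain x c where x: "x \<in> S" "norm x = 1" "A *v x = c *\<^sub>R x"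
    using hermitian_eigenvector_in_subspace[OF A] by blast
  have xx: "hinner x x = 1" using x by (simp add: hinner_self dot_square_norm)
  have xv: "hinner v x = 0" "hinner x v = 0" if "v \<in> F" for v
    using that x(1) hinner_cnj[of v x] by (auto simp: S_def)
  have "x \<notin> F" using xx xv by auto
  moreover have "orthonormal_eigenvectors A (insert x F)"
    using F(3) x(3) xx xv \<open>x \<notin> F\<close> by (auto simp: orthonormal_eigenvectors_def)
  ultimately show ?case
    using F by (intro exI[of _ "insert x F"]) auto
qed

theorem hermitian_diagonalization:
  fixes A :: "complex^'n^'n"
  assumes A: "hermitian_mat A"
  obtains U d where "unitary_mat U" "A = U ** real_diag_mat d ** adjoint_mat U"
proof -
  obtain F where F: "finite F" "card F = CARD('n)" "orthonormal_eigenvectors A F"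
    using orthonormal_eigenvectors_exist[OF A, of "CARD('n)"] by auto
  then obtain f where f: "bij_betw f (UNIV :: 'n set) F"
    using finite_same_card_bij[of "UNIV :: 'n set" F] by auto
  then have fF: "f i \<in> F" for i by (auto simp: bij_betw_def)
  have orth: "hinner (f i) (f j) = (if i = j then 1 else 0)" for i j
    using F(3) fF[of i] fF[of j] inj_eq[of f i j] f
    by (auto simp: orthonormal_eigenvectors_def bij_betw_def)
  have "\<forall>j. \<exists>c. A *v f j = c *\<^sub>R f j"
    using F(3) fF by (auto simp: orthonormal_eigenvectors_def)
  then obtain d where d: "\<And>j. A *v f j = d j *\<^sub>R f j" by metis
  define U :: "complex^'n^'n" where "U = (\<chi> i j. f j $ i)"
  have "adjoint_mat U ** U = mat 1"
    using orth by (simp add: vec_eq_iff matrix_matrix_mult_def adjoint_mat_nth U_def hinner_def mat_def)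
  then have U: "unitary_mat U"
    using matrix_left_right_inverse unfolding unitary_mat_def by blast
  have "(A ** U) $ i $ j = (U ** real_diag_mat d) $ i $ j" for i j
  proof -
    have "(A ** U) $ i $ j = (A *v f j) $ i"
      by (simp add: matrix_matrix_mult_def matrix_vector_mult_def U_def)
    also have "\<dots> = (U ** real_diag_mat d) $ i $ j"
      unfolding mult_real_diag_nth d by (simp add: U_def scaleR_eq_vector_scale mult.commute)
    finally show ?thesis .
  qed
  then have "A ** U = U ** real_diag_mat d" by (simp add: vec_eq_iff)
  then have "A ** (U ** adjoint_mat U) = U ** real_diag_mat d ** adjoint_mat U"
    by (simp add: matrix_mul_assoc)
  then show ?thesis
    using U that[of U d] by (simp add: unitary_mat_def)
qed

section \<open>Functional calculus and polar decomposition\<close>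

abbreviation diag_conj :: "complex^'n^'n \<Rightarrow> ('n \<Rightarrow> real) \<Rightarrow> complex^'n^'n" where
  "diag_conj U d \<equiv> U ** real_diag_mat d ** adjoint_mat U"

lemma diag_conj_mult:
  assumes "unitary_mat U"
  shows "diag_conj U c ** diag_conj U d = diag_conj U (\<lambda>i. c i * d i)"
proof -
  have "diag_conj U c ** diag_conj U d
      = U ** real_diag_mat c ** (adjoint_mat U ** U) ** real_diag_mat d ** adjoint_mat U"
    by (simp add: matrix_mul_assoc)
  also have "\<dots> = diag_conj U (\<lambda>i. c i * d i)"
    using assms by (simp add: unitary_mat_def real_diag_mult flip: matrix_mul_assoc)
  finally show ?thesis .
qed

lemma adjoint_diag_conj: "adjoint_mat (diag_conj U d) = diag_conj U d"
  by (simp add: adjoint_mat_mult matrix_mul_assoc)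

lemma diag_conj_one: "unitary_mat U \<Longrightarrow> diag_conj U (\<lambda>i. 1) = mat 1"
  by (simp add: real_diag_one unitary_mat_def)

lemma tr_diag_conj:
  assumes "unitary_mat U"
  shows "tr (diag_conj U d) = (\<Sum>i\<in>UNIV. d i)"
proof -
  have "trace (diag_conj U d) = trace (adjoint_mat U ** (U ** real_diag_mat d))"
    by (rule trace_mul_sym)
  also have "\<dots> = trace (real_diag_mat d)"
    using assms by (simp add: matrix_mul_assoc unitary_mat_def)
  finally show ?thesis
    by (simp add: tr_def trace_def real_diag_mat_def)
qed

lemma mat_powr_diag_conj:
  "unitary_mat U \<Longrightarrow> mat_powr (diag_conj U d) s = diag_conj U (\<lambda>i. d i powr s)"
  by (simp add: mat_powr_def spectral_fun_eq)

lemma unitary_mat_adjoint: "unitary_mat U \<Longrightarrow> unitary_mat (adjoint_mat U)"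
  by (auto simp: unitary_mat_def)

lemma unitary_mat_mult:
  assumes "unitary_mat U" and "unitary_mat V"
  shows "unitary_mat (U ** V)"
proof -
  have "adjoint_mat (U ** V) ** (U ** V) = adjoint_mat V ** (adjoint_mat U ** U) ** V"
    by (simp add: adjoint_mat_mult matrix_mul_assoc)
  then have "adjoint_mat (U ** V) ** (U ** V) = mat 1"
    using assms by (simp add: unitary_mat_def)
  then show ?thesis
    using matrix_left_right_inverse unfolding unitary_mat_def by blast
qed

lemma positive_definite_diagonalization:
  fixes A :: "complex^'n^'n"
  assumes A: "positive_definite A"
  obtains U d where "unitary_mat U" "A = diag_conj U d" "\<And>i. 0 < d i"
proof -
  obtain U d where U: "unitary_mat U" and Ad: "A = diag_conj U d"
    using A hermitian_diagonalization by (auto simp: positive_definite_def)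
  have "0 < d i" for i
  proof -
    let ?e = "axis i 1 :: complex^'n"
    have "adjoint_mat U *v (U *v ?e) = ?e"
      using U by (simp add: matrix_vector_mul_assoc unitary_mat_def)
    then have "U *v ?e \<noteq> 0"
      by (metis axis_eq_0_iff matrix_vector_mult_0_right zero_neq_one)
    then have "0 < Re (hinner (U *v ?e) (A *v (U *v ?e)))"
      using A by (simp add: positive_definite_def hinner_def)
    also have "hinner (U *v ?e) (A *v (U *v ?e)) = hinner ?e (adjoint_mat U ** A ** U *v ?e)"
      using hinner_adjoint[of "adjoint_mat U" ?e]
      by (simp add: matrix_vector_mul_assoc matrix_mul_assoc)
    also have "adjoint_mat U ** A ** U
        = (adjoint_mat U ** U) ** real_diag_mat d ** (adjoint_mat U ** U)"
      by (simp add: Ad matrix_mul_assoc)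
    also have "\<dots> = real_diag_mat d"
      using U by (simp add: unitary_mat_def)
    also have "hinner ?e (real_diag_mat d *v ?e) = d i"
      by (simp add: hinner_def axis_def matrix_vector_mult_def real_diag_mat_def
          if_distrib[of cnj] if_distrib[of "\<lambda>x. x * _"] if_distrib[of "\<lambda>x. _ * x"] cong: if_cong)
    finally show ?thesis by simp
  qed
  with U Ad show ?thesis by (rule that)
qed

lemma positive_definite_adjoint_mult:
  fixes M :: "complex^'n^'n"
  assumes "N ** M = mat 1"
  shows "positive_definite (adjoint_mat M ** M)"
  unfolding positive_definite_def
proof (intro conjI allI impI)
  show "hermitian_mat (adjoint_mat M ** M)"
    by (simp add: hermitian_mat_def adjoint_mat_mult)
next
  fix x :: "complex^'n" assume "x \<noteq> 0"
  have "N *v (M *v x) = x"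
    using assms by (simp add: matrix_vector_mul_assoc)
  with \<open>x \<noteq> 0\<close> have "M *v x \<noteq> 0" by auto
  moreover have "hinner x ((adjoint_mat M ** M) *v x) = hinner (M *v x) (M *v x)"
    using hinner_adjoint[of "adjoint_mat M" x "M *v x"] by (simp add: matrix_vector_mul_assoc)
  ultimately show "0 < Re (\<Sum>i\<in>UNIV. cnj (x $ i) * ((adjoint_mat M ** M) *v x) $ i)"
    unfolding hinner_def[symmetric] by (simp add: hinner_self)
qed

text \<open>
  The polar decomposition of an invertible matrix. Invertibility makes \<open>M* M\<close> positive definite, so
  that \<open>W = M (M* M)\<^sup>-\<^sup>1\<^sup>/\<^sup>2\<close> makes sense, and \<open>W\<close> is unitary since
  \<open>W* W = (M* M)\<^sup>-\<^sup>1\<^sup>/\<^sup>2 (M* M) (M* M)\<^sup>-\<^sup>1\<^sup>/\<^sup>2 = 1\<close>.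
\<close>

lemma mat_abs_eq_unitary_mult:
  fixes M :: "complex^'n^'n"
  assumes inv: "N ** M = mat 1"
  obtains W where "unitary_mat W" "mat_abs M = adjoint_mat W ** M" "0 \<le> tr (mat_abs M)"
proof -
  obtain R s where R: "unitary_mat R" and Ms: "adjoint_mat M ** M = diag_conj R s"
    and s: "\<And>i. 0 < s i"
    using positive_definite_diagonalization[OF positive_definite_adjoint_mult[OF inv]] by blast
  let ?H = "diag_conj R (\<lambda>i. s i powr (-1/2))"
  define W where "W = M ** ?H"
  have abs: "mat_abs M = diag_conj R (\<lambda>i. s i powr (1/2))"
    unfolding mat_abs_def Ms using R by (rule mat_powr_diag_conj)
  have "s i powr (- 1 / 2) * s i = s i powr (1/2)" for i
    using powr_add[of "s i" "-1/2" 1] s[of i] by simp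
  then have half: "?H ** diag_conj R s = mat_abs M"
    using R by (simp add: diag_conj_mult abs)
  have "adjoint_mat W ** W = ?H ** (adjoint_mat M ** M) ** ?H"
    unfolding W_def adjoint_mat_mult[of M] adjoint_diag_conj by (simp add: matrix_mul_assoc)
  also have "\<dots> = diag_conj R (\<lambda>i. s i powr (1/2) * s i powr (-1/2))"
    unfolding Ms half abs using R by (rule diag_conj_mult)
  also have "(\<lambda>i. s i powr (1/2) * s i powr (-1/2)) = (\<lambda>i. 1)"
    using s by (simp add: fun_eq_iff flip: powr_add) (simp add: less_imp_neq[symmetric])
  finally have "unitary_mat W"
    using R matrix_left_right_inverse unfolding unitary_mat_def diag_conj_one[OF R] by blast
  moreover have "mat_abs M = adjoint_mat W ** M"
    unfolding half[symmetric] Ms[symmetric] W_def adjoint_mat_mult[of M] adjoint_diag_conj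
    by (simp add: matrix_mul_assoc)
  moreover have "0 \<le> tr (mat_abs M)"
    unfolding abs tr_diag_conj[OF R] by (intro sum_nonneg) auto
  ultimately show ?thesis by (rule that)
qed

section \<open>The Hoelder inequality for the trace norm\<close>

lemma unitary_row_sum:
  fixes P :: "complex^'n^'n"
  assumes "unitary_mat P"
  shows "(\<Sum>j\<in>UNIV. (cmod (P $ i $ j))\<^sup>2) = 1"
proof -
  have "(P ** adjoint_mat P) $ i $ i = 1"
    using assms by (simp add: unitary_mat_def mat_def)
  then have "complex_of_real (\<Sum>j\<in>UNIV. (cmod (P $ i $ j))\<^sup>2) = 1"
    by (simp add: matrix_matrix_mult_def adjoint_mat_nth complex_norm_square
        del: of_real_power)
  then show ?thesis by (simp only: of_real_eq_1_iff)
qed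

lemma unitary_col_sum:
  fixes P :: "complex^'n^'n"
  assumes "unitary_mat P"
  shows "(\<Sum>i\<in>UNIV. (cmod (P $ i $ j))\<^sup>2) = 1"
  using unitary_row_sum[OF unitary_mat_adjoint[OF assms], of j] by (simp add: adjoint_mat_nth)

text \<open>
  When \<open>P\<close> and \<open>Q\<close> are unitary, the weights on the right are doubly stochastic. This is where the
  phases of the entries are lost.
\<close>

lemma tr_unitary_diag_le:
  fixes P Q :: "complex^'n^'n"
  assumes c: "\<And>i. 0 \<le> c i" and e: "\<And>i. 0 \<le> e i"
  shows "tr (P ** real_diag_mat c ** (Q ** real_diag_mat e))
    \<le> (\<Sum>i\<in>UNIV. \<Sum>j\<in>UNIV. ((cmod (P $ i $ j))\<^sup>2 + (cmod (Q $ j $ i))\<^sup>2) / 2 * (c j * e i))"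
proof -
  have "trace (P ** real_diag_mat c ** (Q ** real_diag_mat e))
      = (\<Sum>i\<in>UNIV. \<Sum>j\<in>UNIV. (P ** real_diag_mat c) $ i $ j * (Q ** real_diag_mat e) $ j $ i)"
    by (simp add: trace_def matrix_matrix_mult_def[of "P ** real_diag_mat c"])
  then have "tr (P ** real_diag_mat c ** (Q ** real_diag_mat e))
      = (\<Sum>i\<in>UNIV. \<Sum>j\<in>UNIV. Re (P $ i $ j * Q $ j $ i) * (c j * e i))"
    by (simp add: tr_def mult_real_diag_nth algebra_simps)
  also have "\<dots> \<le> (\<Sum>i\<in>UNIV. \<Sum>j\<in>UNIV.
      ((cmod (P $ i $ j))\<^sup>2 + (cmod (Q $ j $ i))\<^sup>2) / 2 * (c j * e i))"
  proof (intro sum_mono mult_right_mono)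
    fix i j
    have "Re (P $ i $ j * Q $ j $ i) \<le> cmod (P $ i $ j) * cmod (Q $ j $ i)"
      using complex_Re_le_cmod[of "P $ i $ j * Q $ j $ i"] by (simp add: norm_mult)
    also have "\<dots> \<le> ((cmod (P $ i $ j))\<^sup>2 + (cmod (Q $ j $ i))\<^sup>2) / 2"
      using sum_squares_bound[of "cmod (P $ i $ j)" "cmod (Q $ j $ i)"] by simp
    finally show "Re (P $ i $ j * Q $ j $ i)
        \<le> ((cmod (P $ i $ j))\<^sup>2 + (cmod (Q $ j $ i))\<^sup>2) / 2" .
  qed (use c e in simp)
  finally show ?thesis .
qed

text \<open>
  After dividing \<open>c\<close> and \<open>e\<close> by their sums \<open>a\<close> and \<open>b\<close>, Young's inequality bounds each term by
  \<open>(1 - \<nu>) c\<^sub>j / a + \<nu> e\<^sub>i / b\<close>. Averaging these against \<open>S\<close> gives \<open>(1 - \<nu>) + \<nu> = 1\<close>: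
  the column sums take care of the first summand and the row sums of the second.
\<close>

lemma doubly_stochastic_Holder:
  fixes S :: "'n::finite \<Rightarrow> 'n \<Rightarrow> real"
  assumes S: "\<And>i j. 0 \<le> S i j" "\<And>i. (\<Sum>j\<in>UNIV. S i j) = 1" "\<And>j. (\<Sum>i\<in>UNIV. S i j) = 1"
    and c: "\<And>j. 0 < c j" and e: "\<And>i. 0 < e i" and \<nu>: "0 \<le> \<nu>" "\<nu> \<le> 1"
  shows "(\<Sum>i\<in>UNIV. \<Sum>j\<in>UNIV. S i j * (c j powr (1 - \<nu>) * e i powr \<nu>))
         \<le> (\<Sum>j\<in>UNIV. c j) powr (1 - \<nu>) * (\<Sum>i\<in>UNIV. e i) powr \<nu>"
proof -
  define a where "a = (\<Sum>j\<in>UNIV. c j)"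
  define b where "b = (\<Sum>i\<in>UNIV. e i)"
  have ab: "0 < a" "0 < b" unfolding a_def b_def using c e by (auto intro!: sum_pos)
  have "(\<Sum>i\<in>UNIV. \<Sum>j\<in>UNIV. S i j * (c j powr (1 - \<nu>) * e i powr \<nu>))
      = a powr (1 - \<nu>) * b powr \<nu> *
        (\<Sum>i\<in>UNIV. \<Sum>j\<in>UNIV. S i j * ((c j / a) powr (1 - \<nu>) * (e i / b) powr \<nu>))"
    using ab c e by (simp add: sum_distrib_left powr_divide less_imp_le mult_ac)
  also have "\<dots> \<le> a powr (1 - \<nu>) * b powr \<nu> *
        (\<Sum>i\<in>UNIV. \<Sum>j\<in>UNIV. S i j * ((1 - \<nu>) * (c j / a) + \<nu> * (e i / b)))"
    using ab c e \<nu> S by (intro mult_left_mono sum_mono Youngs_inequality_0) auto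
  also have "(\<Sum>i\<in>UNIV. \<Sum>j\<in>UNIV. S i j * ((1 - \<nu>) * (c j / a) + \<nu> * (e i / b)))
      = (\<Sum>j\<in>UNIV. \<Sum>i\<in>UNIV. S i j * ((1 - \<nu>) * (c j / a)))
        + (\<Sum>i\<in>UNIV. \<Sum>j\<in>UNIV. S i j * (\<nu> * (e i / b)))"
    by (subst (2) sum.swap) (simp add: distrib_left sum.distrib)
  also have "\<dots> = (1 - \<nu>) * ((\<Sum>j\<in>UNIV. c j) / a) + \<nu> * ((\<Sum>i\<in>UNIV. e i) / b)"
    unfolding sum_distrib_right[symmetric] S by (simp add: sum_distrib_left sum_divide_distrib)
  also have "\<dots> = 1"
    using ab by (simp flip: a_def b_def)
  finally show ?thesis by (simp add: a_def b_def)
qed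

theorem tr_abs_mat_powr_Holder:
  fixes A B :: "complex^'n^'n"
  assumes A: "positive_definite A" and B: "positive_definite B" and \<nu>: "0 \<le> \<nu>" "\<nu> \<le> 1"
  shows "0 \<le> tr (mat_abs (mat_powr A (1 - \<nu>) ** mat_powr B \<nu>))"
    and "tr (mat_abs (mat_powr A (1 - \<nu>) ** mat_powr B \<nu>)) \<le> tr A powr (1 - \<nu>) * tr B powr \<nu>"
proof -
  obtain U c where U: "unitary_mat U" and Ac: "A = diag_conj U c" and c: "\<And>i. 0 < c i"
    using positive_definite_diagonalization[OF A] by blast
  obtain V e where V: "unitary_mat V" and Be: "B = diag_conj V e" and e: "\<And>i. 0 < e i"
    using positive_definite_diagonalization[OF B] by blast
  let ?c = "\<lambda>i. c i powr (1 - \<nu>)" and ?e = "\<lambda>i. e i powr \<nu>"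
  define M where "M = mat_powr A (1 - \<nu>) ** mat_powr B \<nu>"
  have M: "M = diag_conj U ?c ** diag_conj V ?e"
    using U V by (simp add: M_def Ac Be mat_powr_diag_conj)
  have inv: "diag_conj R (\<lambda>i. s i powr (- t)) ** diag_conj R (\<lambda>i. s i powr t) = mat 1"
    if "unitary_mat R" "\<And>i. 0 < s i" for R :: "complex^'n^'n" and s and t :: real
    using that by (simp add: diag_conj_mult less_imp_neq[symmetric] diag_conj_one flip: powr_add)
  have "diag_conj V (\<lambda>i. e i powr (- \<nu>)) ** diag_conj U (\<lambda>i. c i powr (- (1 - \<nu>))) ** M
      = diag_conj V (\<lambda>i. e i powr (- \<nu>))
        ** (diag_conj U (\<lambda>i. c i powr (- (1 - \<nu>))) ** diag_conj U ?c) ** diag_conj V ?e"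
    unfolding M by (simp only: matrix_mul_assoc)
  also have "\<dots> = mat 1"
    unfolding inv[OF U c] using inv[OF V e] by (simp only: matrix_mul_rid)
  finally obtain W where W: "unitary_mat W" and abs: "mat_abs M = adjoint_mat W ** M"
    and nonneg: "0 \<le> tr (mat_abs M)"
    using mat_abs_eq_unitary_mult by metis
  then show "0 \<le> tr (mat_abs (mat_powr A (1 - \<nu>) ** mat_powr B \<nu>))" by (simp add: M_def)
  define P where "P = adjoint_mat V ** (adjoint_mat W ** U)"
  define Q where "Q = adjoint_mat U ** V"
  define S where "S i j = ((cmod (P $ i $ j))\<^sup>2 + (cmod (Q $ j $ i))\<^sup>2) / 2" for i j
  have P: "unitary_mat P" and Q: "unitary_mat Q"
    unfolding P_def Q_def using U V W by (simp_all add: unitary_mat_mult unitary_mat_adjoint)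
  have "trace (mat_abs M)
      = trace ((adjoint_mat W ** diag_conj U ?c ** V ** real_diag_mat ?e) ** adjoint_mat V)"
    unfolding abs unfolding M by (simp only: matrix_mul_assoc)
  also have "\<dots> = trace (P ** real_diag_mat ?c ** (Q ** real_diag_mat ?e))"
    by (subst trace_mul_sym) (simp only: P_def Q_def matrix_mul_assoc)
  finally have "tr (mat_abs M) = tr (P ** real_diag_mat ?c ** (Q ** real_diag_mat ?e))"
    by (simp add: tr_def)
  also have "\<dots> \<le> (\<Sum>i\<in>UNIV. \<Sum>j\<in>UNIV. S i j * (?c j * ?e i))"
    unfolding S_def by (rule tr_unitary_diag_le) auto
  also have "\<dots> \<le> (\<Sum>j\<in>UNIV. c j) powr (1 - \<nu>) * (\<Sum>i\<in>UNIV. e i) powr \<nu>"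
    using c e \<nu> unitary_row_sum[OF P] unitary_col_sum[OF P] unitary_row_sum[OF Q] unitary_col_sum[OF Q]
    by (intro doubly_stochastic_Holder)
      (auto simp: S_def sum.distrib simp flip: sum_divide_distrib)
  finally show "tr (mat_abs (mat_powr A (1 - \<nu>) ** mat_powr B \<nu>))
      \<le> tr A powr (1 - \<nu>) * tr B powr \<nu>"
    by (simp add: M_def Ac Be tr_diag_conj U V)
qed

lemma tr_positive:
  assumes "positive_definite A"
  shows "0 < tr A"
proof -
  obtain U d where "unitary_mat U" "A = diag_conj U d" "\<And>i. 0 < d i"
    using positive_definite_diagonalization[OF assms] by blast
  then show ?thesis by (simp add: tr_diag_conj sum_pos)
qed

section \<open>The trace inequality\<close>

theorem theorem3p4:
  fixes A B :: "complex^'n^'n" and m :: nat and \<nu> r r\<^sub>0 :: real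
  assumes "positive_definite A" and "positive_definite B"
    and "m \<ge> 1"
    and "0 < \<nu>" and "\<nu> \<le> 1"
    and "r = min \<nu> (1 - \<nu>)"
    and "r\<^sub>0 = min (2 * r) (1 - 2 * r)"
  shows "(\<nu> \<le> 1/2 \<longrightarrow>
      tr (mat_abs (mat_powr A (1 - \<nu>) ** mat_powr B \<nu>)) ^ m
        + \<nu> ^ m * (tr A + tr B) ^ m
        - (2 * \<nu> * (tr A * tr B) powr (1/2)
            - r\<^sub>0 * ((tr A * tr B) powr (1/4) - tr A powr (1/2)) ^ 2) ^ m
      \<le> tr ((1 - \<nu>) *\<^sub>R A + \<nu> *\<^sub>R B) ^ m)
    \<and> (1/2 \<le> \<nu> \<longrightarrow>
      tr (mat_abs (mat_powr A (1 - \<nu>) ** mat_powr B \<nu>)) ^ m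
        + (1 - \<nu>) ^ m * (tr A + tr B) ^ m
        - (2 * (1 - \<nu>) * (tr A * tr B) powr (1/2)
            - r\<^sub>0 * ((tr A * tr B) powr (1/4) - tr B powr (1/2)) ^ 2) ^ m
      \<le> tr ((1 - \<nu>) *\<^sub>R A + \<nu> *\<^sub>R B) ^ m)"
proof -
  define X where "X = tr (mat_abs (mat_powr A (1 - \<nu>) ** mat_powr B \<nu>))"
  have X: "0 \<le> X" "X \<le> tr A powr (1 - \<nu>) * tr B powr \<nu>"
    unfolding X_def using tr_abs_mat_powr_Holder[OF assms(1,2)] assms(4,5) by auto
  have pos: "0 < tr A" "0 < tr B" using assms(1,2) by (simp_all add: tr_positive)
  have mean: "tr ((1 - \<nu>) *\<^sub>R A + \<nu> *\<^sub>R B) = (1 - \<nu>) * tr A + \<nu> * tr B"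
    by (simp add: tr_def trace_def sum.distrib sum_distrib_left)
  show ?thesis
    unfolding X_def[symmetric] mean
  proof (intro conjI impI)
    assume "\<nu> \<le> 1/2"
    then have "r\<^sub>0 = min (2 * \<nu>) (1 - 2 * \<nu>)" using assms(6,7) by simp
    then show "X ^ m + \<nu> ^ m * (tr A + tr B) ^ m
        - (2 * \<nu> * (tr A * tr B) powr (1/2)
            - r\<^sub>0 * ((tr A * tr B) powr (1/4) - tr A powr (1/2)) ^ 2) ^ m
        \<le> ((1 - \<nu>) * tr A + \<nu> * tr B) ^ m"
      using power_Young_refined[of "tr A" "tr B" \<nu> m X] \<open>\<nu> \<le> 1/2\<close> X pos assms(3,4) by simp
  next
    assume "1/2 \<le> \<nu>"
    then have "r\<^sub>0 = min (2 * (1 - \<nu>)) (1 - 2 * (1 - \<nu>))" using assms(6,7) by simp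
    then show "X ^ m + (1 - \<nu>) ^ m * (tr A + tr B) ^ m
        - (2 * (1 - \<nu>) * (tr A * tr B) powr (1/2)
            - r\<^sub>0 * ((tr A * tr B) powr (1/4) - tr B powr (1/2)) ^ 2) ^ m
        \<le> ((1 - \<nu>) * tr A + \<nu> * tr B) ^ m"
      using power_Young_refined[of "tr B" "tr A" "1 - \<nu>" m X] \<open>1/2 \<le> \<nu>\<close> X pos assms(3,5)
      by (simp add: mult.commute add.commute)
  qed
qed

end
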